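(* Let $X=\mathrm{puz}(\Gamma_{2,3})$ be the state graph of the cylindrical $5$-puzzle, identified via the encoding $f\mapsto(\sigma_f,x_f,y_f)$ with the Cayley graph $\mathrm{Cay}(G,\{\hat{\mathtt L},\hat{\mathtt R},\hat{\mathtt V}\})$, where $G=S_5\times\mathbb{Z}/2\mathbb{Z}\times\mathbb{Z}/3\mathbb{Z}$. Let $c=c_1c_2\cdots c_{48}$ be the word of length $48$ over $\{\mathtt L,\mathtt R,\mathtt V\}$ given by the concatenation of the following four blocks of twelve letters: $$c=\mathtt{RVLVRVLVRRRV}\;\mathtt{LVRVRVLVLVRV}\;\mathtt{LVLLVRVRVLLL}\;\mathtt{VLVRRRVRVRVR}.$$ Then the $15$-fold repetition of $\hat c=(\hat c_1,\ldots,\hat c_{48})$ traces a Hamiltonian cycle of $X$; that is, writing $c^{15}=(u_1,\ldots,u_{720})$ and $h_0=(\mathrm{id},0,0)$, $h_i=\hat u_1\hat u_2\cdots\hat u_i$ for $1\le i\le 720$, the sequence $(h_0,h_1,\ldots,h_{720})$ is a Hamiltonian cycle in $X$ (so $h_{720}=h_0$ and $h_0,\ldots,h_{719}$ are exactly the $720$ vertices of $X$, each occurring once). In particular, $\mathrm{puz}(\Gamma_{2,3})$ has a Hamiltonian cycle.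
   Context: Sliding block puzzle. For a finite simple graph $\Gamma$ with $n+1$ vertices, a position is a bijection $f:V(\Gamma)\to\{0,1,\ldots,n\}$; the vertex $f^{-1}(0)$ is called blank. A move transforms $f$ into $g=f\circ(v,w)$, where $v,w$ are adjacent vertices of $\Gamma$, one of which is blank in $f$, and $(v,w)$ is the transposition of $v$ and $w$. The state graph $\mathrm{puz}(\Gamma)$ is the undirected graph whose vertices are the positions, with $f,g$ adjacent iff a move transforms $f$ into $g$. The cylindrical grid $\Gamma_{2,3}$ has vertex set $\mathbb{Z}/2\mathbb{Z}\times\mathbb{Z}/3\mathbb{Z}$, with exactly one edge between $v$ and $w$ iff $v-w\in\{\pm(1,0),\pm(0,1)\}$. The puzzle on $\Gamma_{2,3}$ is the cylindrical $5$-puzzle. Conventions for $S_5$: a permutation $\sigma$ is written in one-line notation $\sigma(1)\sigma(2)\sigma(3)\sigma(4)\sigma(5)$ or in cycle notation, and products are compositions $(\sigma\tau)(i)=\sigma(\tau(i))$. Encoding: a position $f$ with blank at $b=(x_f,y_f)$ is encoded as $(\sigma_f,x_f,y_f)\in G=S_5\times\mathbb{Z}/2\mathbb{Z}\times\mathbb{Z}/3\mathbb{Z}$, where $\sigma_f$ has one-line notation $f((0,1)+b)\,f((0,2)+b)\,f((1,0)+b)\,f((1,1)+b)\,f((1,2)+b)$. Put $\mathtt R=(1,2)(3,4,5)$, $\mathtt L=(1,2)(3,5,4)$, $\mathtt V=(1,4)(2,5)$ in $S_5$, and $\hat{\mathtt R}=(\mathtt R,0,1)$, $\hat{\mathtt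 L}=(\mathtt L,0,2)$, $\hat{\mathtt V}=(\mathtt V,1,0)$ in $G$. Moving the blank from $b$ to $b+(0,1)$, $b+(0,2)$, $b+(1,0)$ corresponds to right multiplication by $\hat{\mathtt R}$, $\hat{\mathtt L}$, $\hat{\mathtt V}$ respectively. Thus $\mathrm{puz}(\Gamma_{2,3})$ is identified with $\mathrm{Cay}(G,\{\hat{\mathtt L},\hat{\mathtt R},\hat{\mathtt V}\})$, where $\mathrm{Cay}(H,S)$ has vertex set $H$ and an edge from $h_1$ to $h_2$ iff $h_1\xi=h_2$ for some $\xi\in S$. (Here $\hat{\mathtt R}^{-1}=\hat{\mathtt L}$ and $\hat{\mathtt V}^{-1}=\hat{\mathtt V}$, so the edges may be regarded as undirected.) Powers and juxtaposition of words denote repetition and concatenation. *)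

theory Defs
  imports
    "HOL-Algebra.Sym_Groups"
    "HOL-Algebra.Elementary_Groups"
    "Graph_Theory.Pair_Digraph"
    "Graph_Theory.Vertex_Walk"
begin

text \<open>
  Finite simple graphs are represented as in \<^locale>\<open>pair_graph\<close>: an undirected edge between
  \<open>v\<close> and \<open>w\<close> is the pair of arcs \<open>(v, w)\<close>, \<open>(w, v)\<close>.
\<close>

text \<open>
  A Hamiltonian cycle is given by its closed vertex sequence, the initial vertex being repeated at
  the end. The length bound excludes the degenerate closed walks \<open>v\<close> and \<open>v, w, v\<close>.
\<close>

definition hamiltonian_cycle :: "'a pair_pre_digraph \<Rightarrow> 'a list \<Rightarrow> bool" where
  "hamiltonian_cycle \<Gamma> p \<longleftrightarrow>
     vwalk p (with_proj \<Gamma>) \<and> 4 \<le> length p \<and> hd p = last p \<and>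
     distinct (tl p) \<and> set p = pverts \<Gamma>"

definition graph_isomorphism ::
    "('a \<Rightarrow> 'b) \<Rightarrow> 'a pair_pre_digraph \<Rightarrow> 'b pair_pre_digraph \<Rightarrow> bool" where
  "graph_isomorphism \<phi> \<Gamma> \<Delta> \<longleftrightarrow>
     bij_betw \<phi> (pverts \<Gamma>) (pverts \<Delta>) \<and>
     (\<forall>u\<in>pverts \<Gamma>. \<forall>v\<in>pverts \<Gamma>. (u, v) \<in> parcs \<Gamma> \<longleftrightarrow> (\<phi> u, \<phi> v) \<in> parcs \<Delta>)"

definition Cay :: "('a, 'm) monoid_scheme \<Rightarrow> 'a set \<Rightarrow> 'a pair_pre_digraph" where
  "Cay H S =
     \<lparr>pverts = carrier H,
      parcs = {(h1, h2). h1 \<in> carrier H \<and> h2 \<in> carrier H \<and> (\<exists>\<xi>\<in>S. h1 \<otimes>\<^bsub>H\<^esub> \<xi> = h2)}\<rparr>"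


text \<open>
  Positions are required to be extensional, so that they correspond exactly to the bijections
  defined on the vertex set only. The labels \<open>0, \<dots>, n\<close> are those below the number
  \<open>n + 1\<close> of vertices.
\<close>

definition positions :: "'v pair_pre_digraph \<Rightarrow> ('v \<Rightarrow> nat) set" where
  "positions \<Gamma> =
     {f \<in> extensional (pverts \<Gamma>). bij_betw f (pverts \<Gamma>) {..<card (pverts \<Gamma>)}}"

definition blank :: "'v pair_pre_digraph \<Rightarrow> ('v \<Rightarrow> nat) \<Rightarrow> 'v" where
  "blank \<Gamma> f = the_inv_into (pverts \<Gamma>) f 0"

definition is_move :: "'v pair_pre_digraph \<Rightarrow> ('v \<Rightarrow> nat) \<Rightarrow> ('v \<Rightarrow> nat) \<Rightarrow> bool" where
  "is_move \<Gamma> f g \<longleftrightarrow>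
     (\<exists>v w. (v, w) \<in> parcs \<Gamma> \<and> (v = blank \<Gamma> f \<or> w = blank \<Gamma> f) \<and>
            g = f \<circ> Transposition.transpose v w)"

definition puz :: "'v pair_pre_digraph \<Rightarrow> ('v \<Rightarrow> nat) pair_pre_digraph" where
  "puz \<Gamma> =
     \<lparr>pverts = positions \<Gamma>,
      parcs = {(f, g). f \<in> positions \<Gamma> \<and> g \<in> positions \<Gamma> \<and> is_move \<Gamma> f g}\<rparr>"


text \<open>The additive group \<open>\<int>/2\<int> \<times> \<int>/3\<int>\<close>, written multiplicatively as usual in HOL-Algebra.\<close>

definition grid_group :: "(int \<times> int) monoid" where
  "grid_group = integer_mod_group 2 \<times>\<times> integer_mod_group 3"

definition cyl_grid :: "(int \<times> int) pair_pre_digraph" where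
  "cyl_grid =
     \<lparr>pverts = carrier grid_group,
      parcs = {(v, w). v \<in> carrier grid_group \<and> w \<in> carrier grid_group \<and>
        v \<otimes>\<^bsub>grid_group\<^esub> inv\<^bsub>grid_group\<^esub> w
          \<in> {(1, 0), inv\<^bsub>grid_group\<^esub> (1, 0), (0, 1), inv\<^bsub>grid_group\<^esub> (0, 1)}}\<rparr>"

definition puzzle_group :: "((nat \<Rightarrow> nat) \<times> int \<times> int) monoid" where
  "puzzle_group = sym_group 5 \<times>\<times> grid_group"

definition one_line :: "nat list \<Rightarrow> nat \<Rightarrow> nat" where
  "one_line xs i = (if 1 \<le> i \<and> i \<le> length xs then xs ! (i - 1) else i)"

definition encode :: "(int \<times> int \<Rightarrow> nat) \<Rightarrow> (nat \<Rightarrow> nat) \<times> int \<times> int" where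
  "encode f =
     (let b = blank cyl_grid f
      in (one_line (map (\<lambda>v. f (v \<otimes>\<^bsub>grid_group\<^esub> b)) [(0, 1), (0, 2), (1, 0), (1, 1), (1, 2)]), b))"

datatype letter = L | R | V

fun hat :: "letter \<Rightarrow> (nat \<Rightarrow> nat) \<times> int \<times> int" where
  "hat R = (cycle_of_list [1, 2] \<circ> cycle_of_list [3, 4, 5], 0, 1)"
| "hat L = (cycle_of_list [1, 2] \<circ> cycle_of_list [3, 5, 4], 0, 2)"
| "hat V = (cycle_of_list [1, 4] \<circ> cycle_of_list [2, 5], 1, 0)"

text \<open>The product of the first \<open>i\<close> generators of the word \<open>u\<close>, in order from left to right.\<close>

definition partial_product :: "letter list \<Rightarrow> nat \<Rightarrow> (nat \<Rightarrow> nat) \<times> int \<times> int" where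
  "partial_product u i =
     foldl (\<lambda>g x. g \<otimes>\<^bsub>puzzle_group\<^esub> hat x) \<one>\<^bsub>puzzle_group\<^esub> (take i u)"

definition c_word :: "letter list" where
  "c_word =
     [R,V,L,V,R,V,L,V,R,R,R,V] @
     [L,V,R,V,R,V,L,V,L,V,R,V] @
     [L,V,L,L,V,R,V,R,V,L,L,L] @
     [V,L,V,R,R,R,V,R,V,R,V,R]"

definition hseq :: "nat \<Rightarrow> (nat \<Rightarrow> nat) \<times> int \<times> int" where
  "hseq = partial_product (concat (replicate 15 c_word))"

end

theory Submission
  imports Defs
begin

text \<open>
  Moving the blank is right multiplication by a generator, so \<open>encode\<close> is an isomorphism onto its
  image, and that image contains every vertex reachable from the identity. That the walk along
  \<open>c\<^sup>15\<close> closes up and repeats no vertex is a computation; since the group has order 720, the walk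
  is then Hamiltonian, and its preimage is a Hamiltonian cycle of the puzzle.
\<close>

section \<open>The group of cells and adjacency in the cylindrical grid\<close>

lemma carrier_grid_group:
  "carrier grid_group = {(0, 0), (0, 1), (0, 2), (1, 0), (1, 1), (1, 2)}"
  by (auto simp: grid_group_def carrier_integer_mod_group)

lemma mult_grid_group:
  "v \<otimes>\<^bsub>grid_group\<^esub> w = ((fst v + fst w) mod 2, (snd v + snd w) mod 3)"
  by (simp add: grid_group_def mult_DirProd')

lemma inv_grid_group:
  assumes "v \<in> carrier grid_group"
  shows "inv\<^bsub>grid_group\<^esub> v = (- fst v mod 2, - snd v mod 3)"
  using assms by (cases v) (simp add: grid_group_def carrier_integer_mod_group)

lemma pverts_cyl_grid: "pverts cyl_grid = carrier grid_group"
  by (simp add: cyl_grid_def)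

text \<open>As (1, 0) is its own inverse, the four differences collapse to three, one for each
  letter.\<close>

lemma parcs_cyl_grid_iff:
  "(v, w) \<in> parcs cyl_grid \<longleftrightarrow>
    v \<in> carrier grid_group \<and> w \<in> carrier grid_group \<and>
    ((fst v - fst w) mod 2, (snd v - snd w) mod 3) \<in> {(1, 0), (0, 1), (0, 2)}"
proof -
  have "v \<otimes>\<^bsub>grid_group\<^esub> inv\<^bsub>grid_group\<^esub> w = ((fst v - fst w) mod 2, (snd v - snd w) mod 3)"
    if "w \<in> carrier grid_group"
    using that by (simp add: inv_grid_group mult_grid_group mod_add_right_eq)
  moreover have "inv\<^bsub>grid_group\<^esub> (1, 0) = (1, 0)" "inv\<^bsub>grid_group\<^esub> (0, 1) = (0, 2)"
    by (simp_all add: inv_grid_group carrier_grid_group)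
  ultimately show ?thesis
    by (simp add: cyl_grid_def cong: conj_cong)
qed

lemma parcs_cyl_grid_sym:
  assumes "(v, w) \<in> parcs cyl_grid"
  shows "(w, v) \<in> parcs cyl_grid"
proof -
  \<comment> \<open>Negation fixes (1, 0) and swaps (0, 1) with (0, 2).\<close>
  have neg: "(- a mod 2, - b mod 3) \<in> {(1, 0), (0, 1), (0, 2)}"
    if "(a, b) \<in> {(1, 0), (0, 1), (0, 2)}" for a b :: int
    using that by (elim insertE emptyE Pair_inject; hypsubst; simp)
  have swap: "(fst w - fst v) mod 2 = - ((fst v - fst w) mod 2) mod 2"
    "(snd w - snd v) mod 3 = - ((snd v - snd w) mod 3) mod 3"
    by (simp_all only: mod_minus_eq minus_diff_eq)
  from assms have "v \<in> carrier grid_group" "w \<in> carrier grid_group"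
    and "((fst v - fst w) mod 2, (snd v - snd w) mod 3) \<in> {(1, 0), (0, 1), (0, 2)}"
    unfolding parcs_cyl_grid_iff by iprover+
  with neg[OF this(3)] show ?thesis
    unfolding parcs_cyl_grid_iff swap by iprover
qed

text \<open>Together with \<open>parcs_cyl_grid_cases\<close> this identifies the neighbours of a
  cell with its three translates, so that moves can be indexed by letters.\<close>

lemma parcs_cyl_grid_hat:
  assumes "v \<in> carrier grid_group"
  shows "(v, snd (hat x) \<otimes>\<^bsub>grid_group\<^esub> v) \<in> parcs cyl_grid"
  using assms unfolding parcs_cyl_grid_iff carrier_grid_group
  by (cases x; elim insertE emptyE; hypsubst; simp add: mult_grid_group)

lemma parcs_cyl_grid_cases:
  assumes "(v, w) \<in> parcs cyl_grid"
  obtains x where "w = snd (hat x) \<otimes>\<^bsub>grid_group\<^esub> v"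
proof -
  have "w = ((fst w - fst v + fst v) mod 2, (snd w - snd v + snd v) mod 3)"
  proof -
    have "w \<in> carrier grid_group" using assms by (simp only: parcs_cyl_grid_iff)
    then show ?thesis by (auto simp: carrier_grid_group)
  qed
  then have w: "w = ((fst w - fst v) mod 2, (snd w - snd v) mod 3) \<otimes>\<^bsub>grid_group\<^esub> v"
    by (simp add: mult_grid_group mod_add_left_eq)
  have "((fst w - fst v) mod 2, (snd w - snd v) mod 3) \<in> {(1, 0), (0, 1), (0, 2)}"
    using parcs_cyl_grid_sym[OF assms] by (simp add: parcs_cyl_grid_iff)
  then consider
      "((fst w - fst v) mod 2, (snd w - snd v) mod 3) = snd (hat V)"
    | "((fst w - fst v) mod 2, (snd w - snd v) mod 3) = snd (hat R)"
    | "((fst w - fst v) mod 2, (snd w - snd v) mod 3) = snd (hat L)"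
    by auto
  then show thesis by cases (use that w in metis)+
qed

section \<open>The puzzle group and its generators\<close>

lemma group_grid_group: "group grid_group"
  by (simp add: grid_group_def DirProd_group)

lemma group_puzzle_group: "group puzzle_group"
  by (simp add: puzzle_group_def DirProd_group group_grid_group sym_group_is_group)

lemma carrier_puzzle_group:
  "carrier puzzle_group = {\<sigma>. \<sigma> permutes {1..5}} \<times> carrier grid_group"
  by (auto simp: puzzle_group_def sym_group_carrier)

lemma mult_puzzle_group:
  "(\<sigma>, v) \<otimes>\<^bsub>puzzle_group\<^esub> (\<tau>, w) = (\<sigma> \<circ> \<tau>, v \<otimes>\<^bsub>grid_group\<^esub> w)"
  by (simp add: puzzle_group_def sym_group_mult)

lemma one_puzzle_group: "\<one>\<^bsub>puzzle_group\<^esub> = (id, 0, 0)"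
  by (simp add: puzzle_group_def sym_group_one grid_group_def)

lemma card_puzzle_group: "card (carrier puzzle_group) = 720"
proof -
  have "card {\<sigma>. \<sigma> permutes {1..5::nat}} = fact 5"
    by (rule card_permutations) auto
  then show ?thesis
    by (simp add: carrier_puzzle_group carrier_grid_group card_cartesian_product fact_numeral)
qed

lemma cycle_of_list_permutes_superset: "set cs \<subseteq> S \<Longrightarrow> cycle_of_list cs permutes S"
  using cycle_permutes by (rule permutes_subset)

lemma hat_permutes: "fst (hat x) permutes {1..5}"
  by (cases x)
    (simp_all del: cycle_of_list.simps add: permutes_compose cycle_of_list_permutes_superset)

lemma hat_in_carrier: "hat x \<in> carrier puzzle_group"
proof -
  have "snd (hat x) \<in> carrier grid_group"
    by (cases x) (simp_all del: cycle_of_list.simps add: carrier_grid_group)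
  then show ?thesis using hat_permutes[of x] by (simp add: carrier_puzzle_group mem_Times_iff)
qed

text \<open>Later proofs delete \<open>hat.simps\<close> and use these values, so the cycles stay
  folded. The form \<open>Suc 0\<close> is what the simplifier makes of 1.\<close>

lemma hat_simps:
  "fst (hat R) (Suc 0) = 2" "fst (hat R) 2 = Suc 0" "fst (hat R) 3 = 4" "fst (hat R) 4 = 5" "fst (hat R) 5 = 3"
  "fst (hat L) (Suc 0) = 2" "fst (hat L) 2 = Suc 0" "fst (hat L) 3 = 5" "fst (hat L) 4 = 3" "fst (hat L) 5 = 4"
  "fst (hat V) (Suc 0) = 4" "fst (hat V) 2 = 5" "fst (hat V) 3 = 3" "fst (hat V) 4 = Suc 0" "fst (hat V) 5 = 2"
  "snd (hat R) = (0, 1)" "snd (hat L) = (0, 2)" "snd (hat V) = (1, 0)"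
  by (simp_all add: transpose_def)

section \<open>The walk \<open>hseq\<close> in the puzzle group\<close>

lemma partial_product_0: "partial_product u 0 = \<one>\<^bsub>puzzle_group\<^esub>"
  by (simp add: partial_product_def)

lemma partial_product_Suc:
  assumes "i < length u"
  shows "partial_product u (Suc i) = partial_product u i \<otimes>\<^bsub>puzzle_group\<^esub> hat (u ! i)"
  using assms by (simp add: partial_product_def take_Suc_conv_app_nth)

lemma length_c_word_power: "length (concat (replicate 15 c_word)) = 720"
  by (simp add: length_concat sum_list_replicate c_word_def)

lemma hseq_0: "hseq 0 = (id, 0, 0)"
  by (simp add: hseq_def partial_product_0 one_puzzle_group)

lemma hseq_Suc:
  assumes "i < 720"
  obtains x where "hseq (Suc i) = hseq i \<otimes>\<^bsub>puzzle_group\<^esub> hat x"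
  using assms by (simp add: hseq_def partial_product_Suc length_c_word_power)

lemma hseq_in_carrier: "i \<le> 720 \<Longrightarrow> hseq i \<in> carrier puzzle_group"
proof (induction i)
  case 0
  then show ?case by (simp add: hseq_0 carrier_puzzle_group carrier_grid_group permutes_id)
next
  case (Suc i)
  interpret group puzzle_group by (rule group_puzzle_group)
  obtain x where "hseq (Suc i) = hseq i \<otimes>\<^bsub>puzzle_group\<^esub> hat x"
    using hseq_Suc[of i] Suc.prems by auto
  then show ?case using Suc hat_in_carrier by simp
qed

section \<open>Evaluation of the walk on explicit tuples\<close>

type_synonym state = "int \<times> int \<times> int \<times> int \<times> int \<times> int \<times> int"

text \<open>Functions on \<open>nat\<close> cannot be compared by evaluation, so the one-line
  entries are tabulated, as integers because these compute in binary.\<close>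

definition state :: "(nat \<Rightarrow> nat) \<times> int \<times> int \<Rightarrow> state" where
  "state = (\<lambda>(\<sigma>, x, y). (int (\<sigma> 1), int (\<sigma> 2), int (\<sigma> 3), int (\<sigma> 4), int (\<sigma> 5), x, y))"

text \<open>Right multiplication only rearranges the one-line entries, so no function composition
  has to be evaluated.\<close>

fun step :: "letter \<Rightarrow> state \<Rightarrow> state" where
  "step R (a, b, c, d, e, x, y) = (b, a, d, e, c, x, (y + 1) mod 3)"
| "step L (a, b, c, d, e, x, y) = (b, a, e, c, d, x, (y + 2) mod 3)"
| "step V (a, b, c, d, e, x, y) = (d, e, c, a, b, (x + 1) mod 2, y)"

fun trace :: "letter list \<Rightarrow> state \<Rightarrow> state list" where
  "trace [] s = [s]"
| "trace (x # u) s = s # trace u (step x s)"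

lemma state_mult_hat:
  assumes "g \<in> carrier puzzle_group"
  shows "state (g \<otimes>\<^bsub>puzzle_group\<^esub> hat x) = step x (state g)"
proof -
  obtain \<sigma> a b where g: "g = (\<sigma>, a, b)" by (cases g)
  have "(a, b) \<in> {(0, 0), (0, 1), (0, 2), (1, 0), (1, 1), (1, 2)}"
    using assms by (simp only: g carrier_puzzle_group carrier_grid_group mem_Times_iff snd_conv)
  \<comment> \<open>The group product reduces both coordinates, \<open>step\<close> only the one
    that changes; they agree because the other is already reduced.\<close>
  then have "a mod 2 = a" "b mod 3 = b"
    by (elim insertE emptyE Pair_inject; hypsubst; simp)+
  moreover have "g \<otimes>\<^bsub>puzzle_group\<^esub> hat x =
      (\<sigma> \<circ> fst (hat x), (a + fst (snd (hat x))) mod 2, (b + snd (snd (hat x))) mod 3)"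
    by (cases "hat x") (simp add: g mult_puzzle_group mult_grid_group)
  ultimately show ?thesis
    by (cases x) (simp_all del: hat.simps add: state_def g hat_simps)
qed

text \<open>Permutations of {1..5} fix all other numbers, so the five tabulated values determine
  them.\<close>

lemma inj_on_state: "inj_on state (carrier puzzle_group)"
proof (rule inj_onI)
  fix g h
  assume gh: "g \<in> carrier puzzle_group" "h \<in> carrier puzzle_group" and eq: "state g = state h"
  obtain \<sigma> v \<tau> w where [simp]: "g = (\<sigma>, v)" "h = (\<tau>, w)" by (cases g, cases h)
  have perm: "\<sigma> permutes {1..5}" "\<tau> permutes {1..5}"
    using gh by (auto simp: carrier_puzzle_group)
  have "\<sigma> i = \<tau> i" for i
  proof (cases "i \<in> {1..5}")
    case True
    then have "i \<in> {1, 2, 3, 4, 5}" by auto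
    then show ?thesis using eq by (auto simp: state_def split: prod.splits)
  next
    case False
    then show ?thesis using perm by (simp add: permutes_not_in)
  qed
  then show "g = h" using eq by (auto simp: state_def split: prod.splits)
qed

text \<open>The start \<open>g\<close> is general because the induction absorbs the first letter
  into it, which shortens every nonempty prefix by one.\<close>

lemma trace_foldl:
  "g \<in> carrier puzzle_group \<Longrightarrow>
    trace u (state g) =
      map (\<lambda>i. state (foldl (\<lambda>g x. g \<otimes>\<^bsub>puzzle_group\<^esub> hat x) g (take i u))) [0..<Suc (length u)]"
proof (induction u arbitrary: g)
  case (Cons x u)
  interpret group puzzle_group by (rule group_puzzle_group)
  have "[0..<Suc (length (x # u))] = 0 # map Suc [0..<Suc (length u)]"
    by (simp add: map_Suc_upt upt_conv_Cons del: upt_Suc)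
  then show ?case
    using Cons.IH[of "g \<otimes>\<^bsub>puzzle_group\<^esub> hat x"] Cons.prems
    by (simp add: state_mult_hat[symmetric] hat_in_carrier del: upt_Suc)
qed simp

text \<open>The label \<open>e\<close> is determined by the other four. Distinct keys imply distinct states even
  without injectivity of \<open>key\<close>; on the states of the walk the keys have 15 binary digits.\<close>

fun key :: "state \<Rightarrow> int" where
  "key (a, b, c, d, e, x, y) = a + 8 * (b + 8 * (c + 8 * (d + 8 * (x + 2 * y))))"

text \<open>Sorting into buckets by the lowest binary digit costs one pass per digit, against
  quadratically many comparisons for \<open>distinct\<close>.\<close>

fun radix_distinct :: "nat \<Rightarrow> int list \<Rightarrow> bool" where
  "radix_distinct 0 ks \<longleftrightarrow> length ks \<le> 1"
| "radix_distinct (Suc n) ks \<longleftrightarrow>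
    radix_distinct n (map (\<lambda>k. k div 2) (filter even ks)) \<and>
    radix_distinct n (map (\<lambda>k. k div 2) (filter odd ks))"

text \<open>Equal entries have equal parity and equal halves, so they would share a bucket to the
  end, where a bucket holds at most one entry.\<close>

lemma distinct_if_radix_distinct: "radix_distinct n ks \<Longrightarrow> distinct ks"
proof (induction n arbitrary: ks)
  case 0
  then show ?case by (cases ks) auto
next
  case (Suc n)
  have "distinct (filter even ks)" "distinct (filter odd ks)"
    using Suc.prems Suc.IH[of "map (\<lambda>k. k div 2) (filter even ks)"]
      Suc.IH[of "map (\<lambda>k. k div 2) (filter odd ks)"]
    by (simp_all only: radix_distinct.simps distinct_map simp_thms)
  moreover have "distinct (filter P xs) \<Longrightarrow> distinct (filter (\<lambda>x. \<not> P x) xs) \<Longrightarrow> distinct xs"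
    for P and xs :: "int list"
    by (induction xs) (auto split: if_splits)
  ultimately show ?case by blast
qed

text \<open>\<open>butlast\<close> drops the return to the start. The 15 digits are three for each
  of four labels and three for the cell number x + 2 * y.\<close>

lemma radix_distinct_trace:
  "radix_distinct 15 (map key (butlast (trace (concat (replicate 15 c_word)) (1, 2, 3, 4, 5, 0, 0))))"
  by code_simp

lemma last_trace:
  "last (trace (concat (replicate 15 c_word)) (1, 2, 3, 4, 5, 0, 0)) = (1, 2, 3, 4, 5, 0, 0)"
  by code_simp

lemma trace_hseq:
  "trace (concat (replicate 15 c_word)) (1, 2, 3, 4, 5, 0, 0) = map (state \<circ> hseq) [0..<721]"
proof -
  have "(1, 2, 3, 4, 5, 0, 0) = state \<one>\<^bsub>puzzle_group\<^esub>"
    by (simp add: one_puzzle_group state_def)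
  moreover have "\<one>\<^bsub>puzzle_group\<^esub> \<in> carrier puzzle_group"
    using hseq_in_carrier[of 0] by (simp add: hseq_0 one_puzzle_group)
  ultimately show ?thesis
    by (simp only: trace_foldl length_c_word_power)
      (simp add: hseq_def partial_product_def fun_eq_iff del: upt_Suc)
qed

lemma hseq_720: "hseq 720 = hseq 0"
proof -
  have "state (hseq 720) = state (hseq 0)"
    using last_trace by (simp add: trace_hseq last_map last_upt hseq_0 state_def del: upt_rec_numeral)
  then show ?thesis
    using inj_on_state hseq_in_carrier[of 0] hseq_in_carrier[of 720] by (auto dest: inj_onD)
qed

lemma inj_on_hseq: "inj_on hseq {0..<720}"
proof -
  have "distinct (butlast (trace (concat (replicate 15 c_word)) (1, 2, 3, 4, 5, 0, 0)))"
    using distinct_if_radix_distinct[OF radix_distinct_trace] unfolding distinct_map by blast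
  also have "butlast (trace (concat (replicate 15 c_word)) (1, 2, 3, 4, 5, 0, 0)) =
      map (state \<circ> hseq) [0..<720]"
    using upt_Suc_append[of 0 720] by (simp add: trace_hseq del: upt_rec_numeral)
  finally show ?thesis
    by (simp add: distinct_map inj_on_imageI2 del: upt_rec_numeral)
qed

text \<open>Surjectivity is by counting: 720 different elements exhaust a group of order
  720.\<close>

lemma bij_betw_hseq: "bij_betw hseq {0..<720} (carrier puzzle_group)"
proof -
  have "hseq ` {0..<720} \<subseteq> carrier puzzle_group" using hseq_in_carrier by auto
  moreover have "finite (carrier puzzle_group)" using card_puzzle_group card.infinite by fastforce
  ultimately have "hseq ` {0..<720} = carrier puzzle_group"
    using inj_on_hseq by (intro card_subset_eq) (simp_all add: card_image card_puzzle_group)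
  then show ?thesis using inj_on_hseq by (simp add: bij_betw_def)
qed

lemma hseq_image: "hseq ` {0..<720} = carrier puzzle_group"
  using bij_betw_hseq by (simp add: bij_betw_def)

section \<open>Closed walks, Hamiltonian cycles and their transfer along isomorphisms\<close>

lemma vwalk_arcs_map_upt:
  "set (vwalk_arcs (map f [m..<n])) = {(f i, f (Suc i)) |i. m \<le> i \<and> Suc i < n}"
proof (induction "n - m" arbitrary: m)
  case (Suc k)
  have eq: "[m..<n] = m # [Suc m..<n]" using Suc.hyps by (simp add: upt_conv_Cons)
  have IH: "set (vwalk_arcs (map f [Suc m..<n])) = {(f i, f (Suc i)) |i. Suc m \<le> i \<and> Suc i < n}"
    using Suc by simp
  show ?case
  proof (cases "Suc m < n")
    case True
    then have "set (vwalk_arcs (map f [m..<n])) =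
        insert (f m, f (Suc m)) {(f i, f (Suc i)) |i. Suc m \<le> i \<and> Suc i < n}"
      by (simp add: eq IH hd_map)
    also have "\<dots> = {(f i, f (Suc i)) |i. m \<le> i \<and> Suc i < n}"
      using True by (auto simp: Suc_le_eq intro: le_neq_implies_less)
    finally show ?thesis .
  next
    case False
    then show ?thesis by (auto simp: eq)
  qed
qed auto

lemma vwalk_arcs_map: "vwalk_arcs (map f p) = map (map_prod f f) (vwalk_arcs p)"
  by (induction p rule: vwalk_arcs.induct) auto

lemma set_vwalk_arcs_subset: "set (vwalk_arcs p) \<subseteq> set p \<times> set p"
  by (induction p rule: vwalk_arcs.induct) auto

lemma hamiltonian_cycle_map_upt:
  assumes arcs: "\<And>i. i < n \<Longrightarrow> (f i, f (Suc i)) \<in> parcs \<Gamma>"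
    and bij: "bij_betw f {0..<n} (pverts \<Gamma>)" and closed: "f n = f 0" and n: "3 \<le> n"
  shows "hamiltonian_cycle \<Gamma> (map f [0..<Suc n])"
proof -
  have "{0..<Suc n} = insert n {0..<n}" "{Suc 0..<Suc n} = insert n ({0..<n} - {0})"
    using n by auto
  moreover have "f 0 \<in> f ` {0..<n}" using n by auto
  moreover have "insert (f 0) (f ` ({0..<n} - {0})) = f ` {0..<n}" using n by auto
  ultimately have img: "f ` {0..<Suc n} = pverts \<Gamma>" "f ` {Suc 0..<Suc n} = pverts \<Gamma>"
    using bij closed by (simp_all add: bij_betw_def insert_absorb)
  \<comment> \<open>Trading index 0 for \<open>n\<close> leaves the image unchanged, so injectivity
    on the shifted range follows from cardinality.\<close>
  have "card (f ` {Suc 0..<Suc n}) = card {Suc 0..<Suc n}"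
    using img bij_betw_same_card[OF bij] by simp
  then have "inj_on f {Suc 0..<Suc n}" by (intro eq_card_imp_inj_on) simp
  moreover have "tl (map f [0..<Suc n]) = map f [Suc 0..<Suc n]"
    by (simp only: upt_conv_Cons[of 0 "Suc n"] zero_less_Suc list.map list.sel)
  ultimately have "distinct (tl (map f [0..<Suc n]))"
    by (simp add: distinct_map del: upt_Suc)
  moreover have "vwalk (map f [0..<Suc n]) (with_proj \<Gamma>)"
    using arcs img by (intro vwalkI) (auto simp: vwalk_arcs_map_upt simp del: upt_Suc)
  moreover have "hd (map f [0..<Suc n]) = last (map f [0..<Suc n])"
    using closed by (simp add: hd_map last_map del: upt_Suc)
  moreover have "set (map f [0..<Suc n]) = pverts \<Gamma>"
    using img by (simp del: upt_Suc)
  ultimately show ?thesis using n by (simp add: hamiltonian_cycle_def del: upt_Suc)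
qed

lemma generators_eq_range_hat: "{hat L, hat R, hat V} = range hat"
proof -
  have "UNIV = {L, R, V}" using letter.exhaust by blast
  then show ?thesis by (metis image_insert image_empty)
qed

lemma hamiltonian_cycle_Cay:
  "hamiltonian_cycle (Cay puzzle_group {hat L, hat R, hat V}) (map hseq [0..<721])"
proof -
  let ?\<Gamma> = "Cay puzzle_group (range hat)"
  have "(hseq i, hseq (Suc i)) \<in> parcs ?\<Gamma>" if i: "i < 720" for i
  proof -
    obtain x where "hseq (Suc i) = hseq i \<otimes>\<^bsub>puzzle_group\<^esub> hat x" using hseq_Suc[OF i] .
    then show ?thesis
      using hseq_in_carrier[of i] hseq_in_carrier[of "Suc i"] i by (auto simp: Cay_def)
  qed
  then have "hamiltonian_cycle ?\<Gamma> (map hseq [0..<Suc 720])"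
    using bij_betw_hseq hseq_720 by (intro hamiltonian_cycle_map_upt) (simp_all add: Cay_def)
  moreover have "Suc 720 = 721" by simp
  ultimately show ?thesis unfolding generators_eq_range_hat by (simp only:)
qed

text \<open>Since \<open>graph_isomorphism\<close> states an equivalence for arcs, the inverse
  bijection preserves them too.\<close>

lemma hamiltonian_cycle_inverse_image:
  assumes iso: "graph_isomorphism \<phi> \<Gamma> \<Delta>" and cycle: "hamiltonian_cycle \<Delta> p"
  shows "hamiltonian_cycle \<Gamma> (map (the_inv_into (pverts \<Gamma>) \<phi>) p)"
proof -
  let ?\<psi> = "the_inv_into (pverts \<Gamma>) \<phi>"
  have bij: "bij_betw \<phi> (pverts \<Gamma>) (pverts \<Delta>)" using iso by (simp add: graph_isomorphism_def)
  then have bij': "bij_betw ?\<psi> (pverts \<Delta>) (pverts \<Gamma>)" by (rule bij_betw_the_inv_into)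
  have p: "set p = pverts \<Delta>" "set (vwalk_arcs p) \<subseteq> parcs \<Delta>" "p \<noteq> []" "4 \<le> length p"
    "hd p = last p" "distinct (tl p)"
    using cycle by (auto simp: hamiltonian_cycle_def vwalk_def)
  have "(?\<psi> u, ?\<psi> v) \<in> parcs \<Gamma>" if "(u, v) \<in> set (vwalk_arcs p)" for u v
  proof -
    have uv: "u \<in> pverts \<Delta>" "v \<in> pverts \<Delta>" "(u, v) \<in> parcs \<Delta>"
      using that p set_vwalk_arcs_subset[of p] by auto
    then have "\<phi> (?\<psi> u) = u" "\<phi> (?\<psi> v) = v"
      using bij by (auto simp: f_the_inv_into_f_bij_betw)
    moreover have "?\<psi> u \<in> pverts \<Gamma>" "?\<psi> v \<in> pverts \<Gamma>"
      using uv bij' by (auto simp: bij_betw_def)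
    ultimately show ?thesis
      using iso uv by (simp add: graph_isomorphism_def)
  qed
  moreover have img: "set (map ?\<psi> p) = pverts \<Gamma>"
    using p bij' by (simp add: bij_betw_def)
  ultimately have "vwalk (map ?\<psi> p) (with_proj \<Gamma>)"
    using p by (intro vwalkI) (auto simp: vwalk_arcs_map)
  moreover have "set (tl p) \<subseteq> pverts \<Delta>"
    using p by (metis list.set_sel(2) subsetI)
  then have "distinct (tl (map ?\<psi> p))"
    using p bij' by (auto simp: map_tl[symmetric] distinct_map bij_betw_def intro: inj_on_subset)
  ultimately show ?thesis
    using p img by (simp add: hamiltonian_cycle_def hd_map last_map)
qed

section \<open>Positions and the injectivity of their encoding\<close>

definition nonblank_cells :: "int \<times> int \<Rightarrow> (int \<times> int) list" where
  "nonblank_cells b =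
    map (\<lambda>v. v \<otimes>\<^bsub>grid_group\<^esub> b) [(0, 1), (0, 2), (1, 0), (1, 1), (1, 2)]"

lemma encode_alt:
  "encode f = (one_line (map f (nonblank_cells (blank cyl_grid f))), blank cyl_grid f)"
  by (simp add: encode_def nonblank_cells_def Let_def)

lemma length_nonblank_cells: "length (nonblank_cells b) = 5"
  by (simp add: nonblank_cells_def)

lemma set_nonblank_cells:
  assumes "b \<in> carrier grid_group"
  shows "set (nonblank_cells b) = carrier grid_group - {b}"
  using assms unfolding carrier_grid_group
  by (elim insertE emptyE; hypsubst; simp add: nonblank_cells_def mult_grid_group insert_commute insert_Diff_if)

lemma distinct_nonblank_cells:
  assumes "b \<in> carrier grid_group"
  shows "distinct (nonblank_cells b)"
  using assms unfolding carrier_grid_group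
  by (elim insertE emptyE; hypsubst; simp add: nonblank_cells_def mult_grid_group)

lemma one_line_permutes:
  assumes "distinct xs" "set xs = {1..length xs}"
  shows "one_line xs permutes {1..length xs}"
proof (rule bij_imp_permutes)
  have "bij_betw (\<lambda>i. i - 1) {1..length xs} {..<length xs}"
    by (rule bij_betw_byWitness[where f' = Suc]) auto
  from bij_betw_trans[OF this bij_betw_nth[OF assms(1) refl assms(2)[symmetric]]]
  have "bij_betw ((!) xs \<circ> (\<lambda>i. i - 1)) {1..length xs} {1..length xs}" .
  moreover have "one_line xs i = ((!) xs \<circ> (\<lambda>i. i - 1)) i" if "i \<in> {1..length xs}" for i
    using that by (simp add: one_line_def)
  ultimately show "bij_betw (one_line xs) {1..length xs} {1..length xs}"
    using bij_betw_cong by blast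
qed (auto simp: one_line_def)

text \<open>Equal lengths matter: \<open>one_line\<close> is the identity beyond its list, so [] and
  [1] give the same function.\<close>

lemma one_line_inject:
  assumes "one_line xs = one_line ys" "length xs = length ys"
  shows "xs = ys"
proof (rule nth_equalityI)
  fix i
  assume "i < length xs"
  then show "xs ! i = ys ! i"
    using fun_cong[OF assms(1), of "Suc i"] assms(2) by (simp add: one_line_def)
qed (rule assms)

lemma positions_cyl_grid_iff:
  "f \<in> positions cyl_grid \<longleftrightarrow>
    f \<in> extensional (carrier grid_group) \<and> bij_betw f (carrier grid_group) {..<6}"
proof -
  have "card (carrier grid_group) = 6" by (simp add: carrier_grid_group)
  then show ?thesis by (simp add: positions_def pverts_cyl_grid)
qed

lemma blank_in_carrier:
  assumes "f \<in> positions cyl_grid"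
  shows "blank cyl_grid f \<in> carrier grid_group"
  using assms unfolding blank_def pverts_cyl_grid positions_cyl_grid_iff bij_betw_def
  by (intro the_inv_into_into) auto

lemma position_blank:
  assumes "f \<in> positions cyl_grid"
  shows "f (blank cyl_grid f) = 0"
  using assms unfolding blank_def pverts_cyl_grid positions_cyl_grid_iff
  by (intro f_the_inv_into_f_bij_betw) auto

lemma blank_eqI:
  assumes "f \<in> positions cyl_grid" "v \<in> carrier grid_group" "f v = 0"
  shows "blank cyl_grid f = v"
  using assms the_inv_into_f_f[of f "carrier grid_group" v]
  unfolding blank_def pverts_cyl_grid positions_cyl_grid_iff bij_betw_def by simp

text \<open>Removing the blank and its label 0 leaves a bijection from the five other cells onto
  {1..5}.\<close>

lemma encode_in_carrier:
  assumes f: "f \<in> positions cyl_grid"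
  shows "encode f \<in> carrier puzzle_group"
proof -
  let ?b = "blank cyl_grid f"
  note b = blank_in_carrier[OF f]
  have "bij_betw f (carrier grid_group) {..<6}" using f by (simp add: positions_cyl_grid_iff)
  then have "bij_betw f (carrier grid_group - {?b}) ({..<6} - {0})"
    using b position_blank[OF f] bij_betw_subset[of f _ _ "carrier grid_group - {?b}" "{..<6} - {0}"]
      inj_on_image_set_diff[of f "carrier grid_group" "carrier grid_group" "{?b}"]
    by (simp add: bij_betw_def inj_on_diff)
  moreover have "{..<6} - {0} = {1..5::nat}" by auto
  ultimately have "distinct (map f (nonblank_cells ?b))" "set (map f (nonblank_cells ?b)) = {1..5}"
    using b by (simp_all add: bij_betw_def distinct_map distinct_nonblank_cells set_nonblank_cells)
  then show ?thesis
    using one_line_permutes[of "map f (nonblank_cells ?b)"] b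
    by (simp add: encode_alt carrier_puzzle_group length_nonblank_cells)
qed

lemma inj_on_encode: "inj_on encode (positions cyl_grid)"
proof (rule inj_onI)
  fix f g
  assume f: "f \<in> positions cyl_grid" and g: "g \<in> positions cyl_grid" and eq: "encode f = encode g"
  let ?b = "blank cyl_grid f"
  have b: "blank cyl_grid g = ?b" using eq by (simp add: encode_alt)
  have "map f (nonblank_cells ?b) = map g (nonblank_cells ?b)"
    using eq by (intro one_line_inject) (simp_all add: encode_alt b)
  then have "f v = g v" if "v \<in> carrier grid_group" "v \<noteq> ?b" for v
    using that set_nonblank_cells[OF blank_in_carrier[OF f]] by auto
  moreover have "f ?b = g ?b" using position_blank[OF f] position_blank[OF g] b by simp
  ultimately have "f v = g v" if "v \<in> carrier grid_group" for v using that by metis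
  then show "f = g"
    using f g unfolding positions_cyl_grid_iff by (blast intro: extensionalityI)
qed

section \<open>Moves as right multiplication, and the isomorphism of graphs\<close>

lemma position_transpose:
  assumes f: "f \<in> positions cyl_grid" and v: "v \<in> carrier grid_group" and w: "w \<in> carrier grid_group"
  shows "f \<circ> transpose v w \<in> positions cyl_grid"
proof -
  have "transpose v w permutes carrier grid_group" using v w by (rule permutes_swap_id)
  then have "bij_betw (f \<circ> transpose v w) (carrier grid_group) {..<6}"
    using f unfolding positions_cyl_grid_iff by (blast intro: bij_betw_trans permutes_imp_bij)
  moreover have "f \<circ> transpose v w \<in> extensional (carrier grid_group)"
    using f v w by (auto simp: positions_cyl_grid_iff extensional_def transpose_def)
  ultimately show ?thesis by (simp add: positions_cyl_grid_iff)
qed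

lemma one_line_comp_eqI:
  assumes "\<sigma> permutes {1..5}" "length xs = 5" "length ys = 5"
    and "\<And>i. i \<in> {1, 2, 3, 4, 5} \<Longrightarrow> one_line xs (\<sigma> i) = one_line ys i"
  shows "one_line xs \<circ> \<sigma> = one_line ys"
proof
  fix i :: nat
  have "{1..5} = {1, 2, 3, 4, 5::nat}" by auto
  then consider "i \<in> {1, 2, 3, 4, 5}" | "i \<notin> {1..5}" by blast
  then show "(one_line xs \<circ> \<sigma>) i = one_line ys i"
  proof cases
    case 1
    then show ?thesis using assms(4) by simp
  next
    case 2
    with assms(1) have "\<sigma> i = i" by (rule permutes_not_in)
    then show ?thesis using 2 assms(2,3) by (auto simp: one_line_def)
  qed
qed

text \<open>These are the rearrangements of \<open>step\<close>, now for arbitrary entries.\<close>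

lemma one_line_hat:
  "one_line [p, q, r, s, t] \<circ> fst (hat R) = one_line [q, p, s, t, r]"
  "one_line [p, q, r, s, t] \<circ> fst (hat L) = one_line [q, p, t, r, s]"
  "one_line [p, q, r, s, t] \<circ> fst (hat V) = one_line [s, t, r, p, q]"
  by (intro one_line_comp_eqI[OF hat_permutes];
      (elim insertE emptyE; hypsubst)?; simp del: hat.simps add: hat_simps one_line_def)+

text \<open>Listed from the new blank, the cells are those listed from the old one in another order,
  with \<open>b\<close> in place of the new blank; the transposition undoes this replacement. The
  order obtained is that of \<open>one_line_hat\<close>.\<close>

lemma nonblank_cells_transpose:
  assumes "b \<in> carrier grid_group" "nonblank_cells b = [p, q, r, s, t]"
  shows
    "map (transpose b ((0, 1) \<otimes>\<^bsub>grid_group\<^esub> b)) (nonblank_cells ((0, 1) \<otimes>\<^bsub>grid_group\<^esub> b)) =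
      [q, p, s, t, r]" (is ?right)
    "map (transpose b ((0, 2) \<otimes>\<^bsub>grid_group\<^esub> b)) (nonblank_cells ((0, 2) \<otimes>\<^bsub>grid_group\<^esub> b)) =
      [q, p, t, r, s]" (is ?left)
    "map (transpose b ((1, 0) \<otimes>\<^bsub>grid_group\<^esub> b)) (nonblank_cells ((1, 0) \<otimes>\<^bsub>grid_group\<^esub> b)) =
      [s, t, r, p, q]" (is ?vertical)
proof -
  have cells: "p = (0, 1) \<otimes>\<^bsub>grid_group\<^esub> b" "q = (0, 2) \<otimes>\<^bsub>grid_group\<^esub> b"
    "r = (1, 0) \<otimes>\<^bsub>grid_group\<^esub> b" "s = (1, 1) \<otimes>\<^bsub>grid_group\<^esub> b" "t = (1, 2) \<otimes>\<^bsub>grid_group\<^esub> b"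
    using assms(2) by (simp_all add: nonblank_cells_def)
  have b: "b \<in> {(0, 0), (0, 1), (0, 2), (1, 0), (1, 1), (1, 2)}"
    using assms(1) by (simp only: carrier_grid_group)
  show ?right using b unfolding cells
    by (elim insertE emptyE; hypsubst; simp add: nonblank_cells_def mult_grid_group transpose_def)
  show ?left using b unfolding cells
    by (elim insertE emptyE; hypsubst; simp add: nonblank_cells_def mult_grid_group transpose_def)
  show ?vertical using b unfolding cells
    by (elim insertE emptyE; hypsubst; simp add: nonblank_cells_def mult_grid_group transpose_def)
qed

lemma encode_transpose:
  assumes f: "f \<in> positions cyl_grid"
  defines "b \<equiv> blank cyl_grid f"
  shows "encode (f \<circ> transpose b (snd (hat x) \<otimes>\<^bsub>grid_group\<^esub> b)) =
    encode f \<otimes>\<^bsub>puzzle_group\<^esub> hat x"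
proof -
  define w where "w = snd (hat x) \<otimes>\<^bsub>grid_group\<^esub> b"
  define g where "g = f \<circ> transpose b w"
  have b: "b \<in> carrier grid_group" using blank_in_carrier[OF f] by (simp add: b_def)
  have w: "w \<in> carrier grid_group"
    using parcs_cyl_grid_hat[OF b, of x] by (simp add: w_def parcs_cyl_grid_iff)
  have g: "g \<in> positions cyl_grid" unfolding g_def using f b w by (rule position_transpose)
  have "g w = 0" using position_blank[OF f] by (simp add: g_def b_def)
  then have bg: "blank cyl_grid g = w" using g w by (intro blank_eqI)
  obtain p q r s t where cells: "nonblank_cells b = [p, q, r, s, t]"
    by (simp add: nonblank_cells_def)
  have "one_line (map g (nonblank_cells w)) = one_line (map f (nonblank_cells b)) \<circ> fst (hat x)"
  proof (cases x)
    case L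
    then have "map (transpose b w) (nonblank_cells w) = [q, p, t, r, s]"
      using nonblank_cells_transpose(2)[OF b cells] by (simp add: w_def)
    then show ?thesis
      unfolding g_def map_map[symmetric] L cells list.map one_line_hat by simp
  next
    case R
    then have "map (transpose b w) (nonblank_cells w) = [q, p, s, t, r]"
      using nonblank_cells_transpose(1)[OF b cells] by (simp add: w_def)
    then show ?thesis
      unfolding g_def map_map[symmetric] R cells list.map one_line_hat by simp
  next
    case V
    then have "map (transpose b w) (nonblank_cells w) = [s, t, r, p, q]"
      using nonblank_cells_transpose(3)[OF b cells] by (simp add: w_def)
    then show ?thesis
      unfolding g_def map_map[symmetric] V cells list.map one_line_hat by simp
  qed
  \<comment> \<open>Cells are translated from the left but the generator multiplies from the right;
    commutativity of the grid group reconciles the two.\<close>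
  moreover have "w = b \<otimes>\<^bsub>grid_group\<^esub> snd (hat x)"
    by (simp add: w_def mult_grid_group add.commute)
  ultimately have "encode g = encode f \<otimes>\<^bsub>puzzle_group\<^esub> hat x"
    by (cases "hat x") (simp add: encode_alt bg mult_puzzle_group b_def)
  then show ?thesis by (simp add: g_def w_def)
qed

text \<open>The image contains the identity and is closed under right multiplication by generators,
  so it contains the whole walk, which covers the group.\<close>

lemma encode_image: "encode ` positions cyl_grid = carrier puzzle_group"
proof
  show "encode ` positions cyl_grid \<subseteq> carrier puzzle_group" using encode_in_carrier by auto
next
  \<comment> \<open>The solved position: blank at (0, 0) and the other cells read 1, 2, 3, 4, 5 in
    order, so its encoding is the identity.\<close>
  define f0 where "f0 = restrict (\<lambda>(x, y). nat (3 * x + y)) (carrier grid_group)"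
  have "bij_betw f0 (carrier grid_group) {..<6}"
    by (auto simp: f0_def bij_betw_def carrier_grid_group lessThan_nat_numeral lessThan_Suc)
  then have f0: "f0 \<in> positions cyl_grid" by (simp add: positions_cyl_grid_iff f0_def)
  have "blank cyl_grid f0 = (0, 0)"
    using f0 by (rule blank_eqI) (simp_all add: f0_def carrier_grid_group)
  then have "encode f0 = (one_line [1, 2, 3, 4, 5], 0, 0)"
    by (simp add: encode_def mult_grid_group f0_def carrier_grid_group)
  also have "\<dots> = hseq 0"
    by (auto simp: hseq_0 one_line_def fun_eq_iff nth_Cons')
  finally have enc0: "encode f0 = hseq 0" .
  have "hseq i \<in> encode ` positions cyl_grid" if "i \<le> 720" for i
    using that
  proof (induction i)
    case 0
    then show ?case using f0 enc0 by (metis imageI)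
  next
    case (Suc i)
    then obtain f where f: "f \<in> positions cyl_grid" "hseq i = encode f" by auto
    obtain x where x: "hseq (Suc i) = hseq i \<otimes>\<^bsub>puzzle_group\<^esub> hat x"
      using hseq_Suc[of i] Suc.prems by auto
    let ?b = "blank cyl_grid f"
    let ?g = "f \<circ> transpose ?b (snd (hat x) \<otimes>\<^bsub>grid_group\<^esub> ?b)"
    have "?g \<in> positions cyl_grid"
      using f(1) blank_in_carrier[OF f(1)] parcs_cyl_grid_hat[OF blank_in_carrier[OF f(1)], of x]
      by (intro position_transpose) (simp_all add: parcs_cyl_grid_iff)
    moreover have "encode ?g = hseq (Suc i)" using encode_transpose[OF f(1)] f(2) x by simp
    ultimately show ?case by (metis imageI)
  qed
  then show "carrier puzzle_group \<subseteq> encode ` positions cyl_grid" by (auto simp flip: hseq_image)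
qed

lemma is_move_iff:
  assumes f: "f \<in> positions cyl_grid"
  shows "is_move cyl_grid f g \<longleftrightarrow>
    (\<exists>x. g = f \<circ> transpose (blank cyl_grid f) (snd (hat x) \<otimes>\<^bsub>grid_group\<^esub> blank cyl_grid f))"
proof
  assume "is_move cyl_grid f g"
  then obtain v w where vw: "(v, w) \<in> parcs cyl_grid" "v = blank cyl_grid f \<or> w = blank cyl_grid f"
    "g = f \<circ> transpose v w"
    by (auto simp: is_move_def)
  \<comment> \<open>The blank may be either end of the edge; symmetry of arcs and of transpositions
    puts it first.\<close>
  then have "\<exists>u. (blank cyl_grid f, u) \<in> parcs cyl_grid \<and> g = f \<circ> transpose (blank cyl_grid f) u"
    using vw parcs_cyl_grid_sym[OF vw(1)] transpose_commute[of v w] by metis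
  then obtain u where u: "(blank cyl_grid f, u) \<in> parcs cyl_grid"
    "g = f \<circ> transpose (blank cyl_grid f) u" by blast
  from u(1) obtain x where "u = snd (hat x) \<otimes>\<^bsub>grid_group\<^esub> blank cyl_grid f"
    by (rule parcs_cyl_grid_cases)
  with u(2) show "\<exists>x. g = f \<circ> transpose (blank cyl_grid f) (snd (hat x) \<otimes>\<^bsub>grid_group\<^esub> blank cyl_grid f)"
    by blast
next
  assume "\<exists>x. g = f \<circ> transpose (blank cyl_grid f) (snd (hat x) \<otimes>\<^bsub>grid_group\<^esub> blank cyl_grid f)"
  then show "is_move cyl_grid f g"
    unfolding is_move_def using parcs_cyl_grid_hat[OF blank_in_carrier[OF f]] by blast
qed

lemma graph_isomorphism_encode:
  "graph_isomorphism encode (puz cyl_grid) (Cay puzzle_group {hat L, hat R, hat V})"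
proof -
  have "is_move cyl_grid f g \<longleftrightarrow> (\<exists>\<xi>\<in>range hat. encode f \<otimes>\<^bsub>puzzle_group\<^esub> \<xi> = encode g)"
    if f: "f \<in> positions cyl_grid" and g: "g \<in> positions cyl_grid" for f g
  proof -
    let ?b = "blank cyl_grid f"
    let ?g = "\<lambda>x. f \<circ> transpose ?b (snd (hat x) \<otimes>\<^bsub>grid_group\<^esub> ?b)"
    have "?g x \<in> positions cyl_grid" for x
      using f blank_in_carrier[OF f] parcs_cyl_grid_hat[OF blank_in_carrier[OF f], of x]
      by (intro position_transpose) (simp_all add: parcs_cyl_grid_iff)
    \<comment> \<open>The product is the encoding of \<open>?g x\<close>, and \<open>encode\<close>
      is injective on positions, so equal encodings force equal positions.\<close>
    then have "g = ?g x \<longleftrightarrow> encode f \<otimes>\<^bsub>puzzle_group\<^esub> hat x = encode g" for x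
      using encode_transpose[OF f, of x] inj_onD[OF inj_on_encode, of "?g x" g] g by metis
    then have "is_move cyl_grid f g \<longleftrightarrow> (\<exists>x. encode f \<otimes>\<^bsub>puzzle_group\<^esub> hat x = encode g)"
      by (simp only: is_move_iff[OF f])
    also have "\<dots> \<longleftrightarrow> (\<exists>\<xi>\<in>range hat. encode f \<otimes>\<^bsub>puzzle_group\<^esub> \<xi> = encode g)"
      by blast
    finally show ?thesis .
  qed
  then show ?thesis
    unfolding generators_eq_range_hat
    using inj_on_encode encode_image encode_in_carrier
    by (simp add: graph_isomorphism_def puz_def Cay_def bij_betw_def)
qed

theorem theorem2:
  shows "graph_isomorphism encode (puz cyl_grid) (Cay puzzle_group {hat L, hat R, hat V})
    \<and> hamiltonian_cycle (Cay puzzle_group {hat L, hat R, hat V}) (map hseq [0..<721])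
    \<and> hseq 720 = hseq 0
    \<and> bij_betw hseq {0..<720} (carrier puzzle_group)
    \<and> hamiltonian_cycle (puz cyl_grid)
          (map (\<lambda>i. the_inv_into (positions cyl_grid) encode (hseq i)) [0..<721])
    \<and> (\<exists>p. hamiltonian_cycle (puz cyl_grid) p)"
proof -
  have "hamiltonian_cycle (puz cyl_grid)
      (map (\<lambda>i. the_inv_into (positions cyl_grid) encode (hseq i)) [0..<721])"
    using hamiltonian_cycle_inverse_image[OF graph_isomorphism_encode hamiltonian_cycle_Cay]
    by (simp add: puz_def comp_def del: upt_rec_numeral)
  then show ?thesis
    using graph_isomorphism_encode hamiltonian_cycle_Cay hseq_720 bij_betw_hseq by blast
qed

end
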